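(* (Polynomially Many vs. All.) Let $f:\mathbb{N}\to\mathbb{N}$ satisfy $\lim_{n\to\infty} f(n) = \infty$ and $f(n) = O(n^k)$ for some constant $k$. Then for every $\varepsilon>0$ there is a constant $C$, independent of $n$ (the paper writes $O_{k,\varepsilon}(1)$), such that for every $n$ and every set $\mathcal{A} \subseteq \{0,1\}^n$ with $|\mathcal{A}| = f(n)$, there is a first-order $\tau_{\mathsf{string}}$-sentence with at most $(1+\varepsilon)\log(n) + C$ quantifiers that is true in $\mathbf{B}_w$ for every $w \in \mathcal{A}$ and false in $\mathbf{B}_{w'}$ for every $w' \in \{0,1\}^n \setminus \mathcal{A}$.
   Context: $\tau_{\mathsf{string}} = \langle <, S; \mathsf{min}, \mathsf{max}\rangle$ with $<$ binary, $S$ unary, $\mathsf{min},\mathsf{max}$ constants. A string $w = w_1\cdots w_n \in \{0,1\}^n$ is encoded by the structure $\mathbf{B}_w$ with universe $\{1,\dots,n\}$, $<$ the usual order, $S = \{i : w_i = 1\}$, $\mathsf{min}=1$, $\mathsf{max}=n$. The number of quantifiers of a sentence is the number of quantifier occurrences. $\log$ is base 2. *)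

theory Defs
  imports Complex_Main "HOL-Library.Landau_Symbols"
begin

datatype trm = Var nat | MinC | MaxC

datatype fm =
    Less trm trm
  | S trm
  | Eq trm trm
  | Neg fm
  | Conj fm fm
  | Disj fm fm
  | Imp fm fm
  | Exists nat fm
  | Forall nat fm

primrec trm_vars :: "trm \<Rightarrow> nat set" where
  "trm_vars (Var x) = {x}"
| "trm_vars MinC = {}"
| "trm_vars MaxC = {}"

primrec free_vars :: "fm \<Rightarrow> nat set" where
  "free_vars (Less s t) = trm_vars s \<union> trm_vars t"
| "free_vars (S t) = trm_vars t"
| "free_vars (Eq s t) = trm_vars s \<union> trm_vars t"
| "free_vars (Neg \<phi>) = free_vars \<phi>"
| "free_vars (Conj \<phi> \<psi>) = free_vars \<phi> \<union> free_vars \<psi>"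
| "free_vars (Disj \<phi> \<psi>) = free_vars \<phi> \<union> free_vars \<psi>"
| "free_vars (Imp \<phi> \<psi>) = free_vars \<phi> \<union> free_vars \<psi>"
| "free_vars (Exists x \<phi>) = free_vars \<phi> - {x}"
| "free_vars (Forall x \<phi>) = free_vars \<phi> - {x}"

definition sentence :: "fm \<Rightarrow> bool" where
  "sentence \<phi> \<longleftrightarrow> free_vars \<phi> = {}"

primrec quantifiers :: "fm \<Rightarrow> nat" where
  "quantifiers (Less s t) = 0"
| "quantifiers (S t) = 0"
| "quantifiers (Eq s t) = 0"
| "quantifiers (Neg \<phi>) = quantifiers \<phi>"
| "quantifiers (Conj \<phi> \<psi>) = quantifiers \<phi> + quantifiers \<psi>"
| "quantifiers (Disj \<phi> \<psi>) = quantifiers \<phi> + quantifiers \<psi>"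
| "quantifiers (Imp \<phi> \<psi>) = quantifiers \<phi> + quantifiers \<psi>"
| "quantifiers (Exists x \<phi>) = Suc (quantifiers \<phi>)"
| "quantifiers (Forall x \<phi>) = Suc (quantifiers \<phi>)"

record 'a string_structure =
  universe :: "'a set"
  less_rel :: "('a \<times> 'a) set"
  S_rel :: "'a set"
  min_const :: 'a
  max_const :: 'a

primrec trm_val :: "'a string_structure \<Rightarrow> (nat \<Rightarrow> 'a) \<Rightarrow> trm \<Rightarrow> 'a" where
  "trm_val M e (Var x) = e x"
| "trm_val M e MinC = min_const M"
| "trm_val M e MaxC = max_const M"

primrec sat :: "'a string_structure \<Rightarrow> (nat \<Rightarrow> 'a) \<Rightarrow> fm \<Rightarrow> bool" where
  "sat M e (Less s t) \<longleftrightarrow> (trm_val M e s, trm_val M e t) \<in> less_rel M"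
| "sat M e (S t) \<longleftrightarrow> trm_val M e t \<in> S_rel M"
| "sat M e (Eq s t) \<longleftrightarrow> trm_val M e s = trm_val M e t"
| "sat M e (Neg \<phi>) \<longleftrightarrow> \<not> sat M e \<phi>"
| "sat M e (Conj \<phi> \<psi>) \<longleftrightarrow> sat M e \<phi> \<and> sat M e \<psi>"
| "sat M e (Disj \<phi> \<psi>) \<longleftrightarrow> sat M e \<phi> \<or> sat M e \<psi>"
| "sat M e (Imp \<phi> \<psi>) \<longleftrightarrow> (sat M e \<phi> \<longrightarrow> sat M e \<psi>)"
| "sat M e (Exists x \<phi>) \<longleftrightarrow> (\<exists>a\<in>universe M. sat M (e(x := a)) \<phi>)"
| "sat M e (Forall x \<phi>) \<longleftrightarrow> (\<forall>a\<in>universe M. sat M (e(x := a)) \<phi>)"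

text \<open>For a sentence and a structure with nonempty universe the choice of the assignment
  is irrelevant, so the negation of \<open>true_in M \<phi>\<close> says that \<open>\<phi>\<close> is false in \<open>M\<close>.\<close>

definition true_in :: "'a string_structure \<Rightarrow> fm \<Rightarrow> bool" where
  "true_in M \<phi> \<longleftrightarrow> (\<forall>e. range e \<subseteq> universe M \<longrightarrow> sat M e \<phi>)"

text \<open>Positions of a string are numbered from 1, list indices from 0. The letter 1 is \<open>True\<close>.\<close>

definition string_struct :: "bool list \<Rightarrow> nat string_structure" where
  "string_struct w =
    \<lparr> universe = {1..length w},
      less_rel = {(i, j). i \<in> {1..length w} \<and> j \<in> {1..length w} \<and> i < j},
      S_rel = {i \<in> {1..length w}. w ! (i - 1)},
      min_const = 1,
      max_const = length w \<rparr>"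

definition strings :: "nat \<Rightarrow> bool list set" where
  "strings n = {w. length w = n}"

end

theory Submission
  imports Defs "HOL-Library.FuncSet"
begin

text \<open>A disjunction of formulas with the same quantifier prefix costs no additional quantifiers when
  its disjuncts are guarded by mutually exclusive quantifier-free conditions, because the guards can
  be moved inside the prefix. With a constant number \<open>t\<close> of existential variables marking distinct
  positions and \<open>m\<close> further ones, there are \<open>t ^ m\<close> such guards (which of the \<open>m\<close> equals which
  mark). Since \<open>t\<close> can be chosen as a large constant, \<open>m = \<epsilon>/2 * log n + O(1)\<close> suffices for
  \<open>t ^ m \<ge> n ^ (k + 1)\<close>. The sentence then says: some \<open>u \<in> A\<close> is announced in this way
  such that for every position \<open>x\<close> some number \<open>i\<close> is announced in this way with \<open>x = i\<close> and the letter
  at \<open>x\<close> equal to \<open>u\<^sub>i\<close>. Here \<open>x = i\<close> means that the distance of \<open>x\<close> from \<open>min\<close> is at most \<open>i - 1\<close>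
  and the one from \<open>max\<close> at most \<open>n - i\<close>, which is expressible by an alternating prefix of length
  \<open>log n + O(1)\<close>: splitting an interval of length at most \<open>a + b\<close> existentially yields two intervals
  of lengths at most \<open>a\<close> and \<open>b\<close>, while splitting an interval of length at most \<open>a + b + 1\<close> at every
  point leaves the first part of length at most \<open>a\<close> or the second one of length at most \<open>b\<close>; the
  two kinds of splitting alternate so that the two resulting claims share a quantifier.\<close>

section \<open>Dependence on free variables, and the structures of strings\<close>

lemma trm_val_cong:
  "(\<And>x. x \<in> trm_vars t \<Longrightarrow> e x = e' x) \<Longrightarrow> trm_val M e t = trm_val M e' t"
  by (cases t) auto

lemma sat_cong:
  "(\<And>x. x \<in> free_vars \<phi> \<Longrightarrow> e x = e' x) \<Longrightarrow> sat M e \<phi> = sat M e' \<phi>"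
proof (induction \<phi> arbitrary: e e')
  case (Less s t)
  then show ?case using trm_val_cong[of s e e' M] trm_val_cong[of t e e' M] by simp
next
  case (S t)
  then show ?case using trm_val_cong[of t e e' M] by simp
next
  case (Eq s t)
  then show ?case using trm_val_cong[of s e e' M] trm_val_cong[of t e e' M] by simp
next
  case (Neg \<phi>)
  then have "sat M e \<phi> = sat M e' \<phi>" by (intro Neg.IH) simp
  then show ?case by simp
next
  case (Conj \<phi> \<psi>)
  have "sat M e \<phi> = sat M e' \<phi>" "sat M e \<psi> = sat M e' \<psi>"
    using Conj.prems by (auto intro!: Conj.IH)
  then show ?case by simp
next
  case (Disj \<phi> \<psi>)
  have "sat M e \<phi> = sat M e' \<phi>" "sat M e \<psi> = sat M e' \<psi>"
    using Disj.prems by (auto intro!: Disj.IH)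
  then show ?case by simp
next
  case (Imp \<phi> \<psi>)
  have "sat M e \<phi> = sat M e' \<phi>" "sat M e \<psi> = sat M e' \<psi>"
    using Imp.prems by (auto intro!: Imp.IH)
  then show ?case by simp
next
  case (Exists x \<phi>)
  have "sat M (e(x := a)) \<phi> = sat M (e'(x := a)) \<phi>" for a
    using Exists.prems by (intro Exists.IH) auto
  then show ?case by simp
next
  case (Forall x \<phi>)
  have "sat M (e(x := a)) \<phi> = sat M (e'(x := a)) \<phi>" for a
    using Forall.prems by (intro Forall.IH) auto
  then show ?case by simp
qed

lemma string_struct_simps:
  assumes "w \<in> strings n"
  shows "universe (string_struct w) = {1..n}"
    and "(i, j) \<in> less_rel (string_struct w) \<longleftrightarrow> i \<in> {1..n} \<and> j \<in> {1..n} \<and> i < j"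
    and "i \<in> S_rel (string_struct w) \<longleftrightarrow> i \<in> {1..n} \<and> w ! (i - 1)"
    and "min_const (string_struct w) = 1"
    and "max_const (string_struct w) = n"
  using assms by (auto simp: string_struct_def strings_def)

section \<open>Definability by a prescribed quantifier prefix\<close>

text \<open>In a prefix, \<open>True\<close> stands for an existential and \<open>False\<close> for a universal quantifier. Variables
  are de Bruijn levels: in scope \<open>d\<close> the variables below \<open>d\<close> are bound outside, and the next
  quantifier binds \<open>d\<close>.\<close>

primrec prefix_definable ::
    "nat \<Rightarrow> nat \<Rightarrow> bool list \<Rightarrow> (bool list \<Rightarrow> (nat \<Rightarrow> nat) \<Rightarrow> bool) \<Rightarrow> bool" where
  "prefix_definable n d [] P \<longleftrightarrow>
    (\<exists>\<phi>. quantifiers \<phi> = 0 \<and> free_vars \<phi> \<subseteq> {..<d} \<and>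
      (\<forall>w\<in>strings n. \<forall>e. range e \<subseteq> {1..n} \<longrightarrow> (sat (string_struct w) e \<phi> \<longleftrightarrow> P w e)))"
| "prefix_definable n d (q # Q) P \<longleftrightarrow>
    (\<exists>R. prefix_definable n (Suc d) Q R \<and>
      (\<forall>w\<in>strings n. \<forall>e. range e \<subseteq> {1..n} \<longrightarrow>
        (P w e \<longleftrightarrow> (if q then \<exists>a\<in>{1..n}. R w (e(d := a)) else \<forall>a\<in>{1..n}. R w (e(d := a))))))"

lemma prefix_definable_Ex:
  assumes "prefix_definable n (Suc d) Q R"
    and "\<And>w e. w \<in> strings n \<Longrightarrow> range e \<subseteq> {1..n} \<Longrightarrow>
      P w e \<longleftrightarrow> (\<exists>a\<in>{1..n}. R w (e(d := a)))"
  shows "prefix_definable n d (True # Q) P"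
  unfolding prefix_definable.simps if_True using assms by blast

lemma prefix_definable_All:
  assumes "prefix_definable n (Suc d) Q R"
    and "\<And>w e. w \<in> strings n \<Longrightarrow> range e \<subseteq> {1..n} \<Longrightarrow>
      P w e \<longleftrightarrow> (\<forall>a\<in>{1..n}. R w (e(d := a)))"
  shows "prefix_definable n d (False # Q) P"
  unfolding prefix_definable.simps if_False using assms by blast

lemma range_fun_upd: "range e \<subseteq> X \<Longrightarrow> a \<in> X \<Longrightarrow> range (e(d := a)) \<subseteq> X"
  by auto

lemma prefix_definable_formula:
  assumes "prefix_definable n d Q P"
  shows "\<exists>\<phi>. quantifiers \<phi> = length Q \<and> free_vars \<phi> \<subseteq> {..<d} \<and>
    (\<forall>w\<in>strings n. \<forall>e. range e \<subseteq> {1..n} \<longrightarrow> (sat (string_struct w) e \<phi> \<longleftrightarrow> P w e))"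
  using assms
proof (induction Q arbitrary: d P)
  case Nil
  then show ?case by simp
next
  case (Cons q Q)
  then obtain R where R: "prefix_definable n (Suc d) Q R"
    and P: "\<And>w e. w \<in> strings n \<Longrightarrow> range e \<subseteq> {1..n} \<Longrightarrow>
      P w e \<longleftrightarrow> (if q then \<exists>a\<in>{1..n}. R w (e(d := a)) else \<forall>a\<in>{1..n}. R w (e(d := a)))"
    by auto
  from Cons.IH[OF R] obtain \<phi> where \<phi>: "quantifiers \<phi> = length Q" "free_vars \<phi> \<subseteq> {..<Suc d}"
    and sat: "\<And>w e. w \<in> strings n \<Longrightarrow> range e \<subseteq> {1..n} \<Longrightarrow> sat (string_struct w) e \<phi> \<longleftrightarrow> R w e"
    by blast
  have "sat (string_struct w) e (if q then Exists d \<phi> else Forall d \<phi>) \<longleftrightarrow> P w e"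
    if "w \<in> strings n" "range e \<subseteq> {1..n}" for w e
    using P[OF that] sat[OF that(1) range_fun_upd[OF that(2)]] string_struct_simps(1)[OF that(1)]
    by simp
  moreover have "free_vars (if q then Exists d \<phi> else Forall d \<phi>) \<subseteq> {..<d}"
    using \<phi>(2) by (auto simp: less_Suc_eq)
  ultimately show ?case
    using \<phi>(1) by (intro exI[of _ "if q then Exists d \<phi> else Forall d \<phi>"]) auto
qed

text \<open>A defining formula has its free variables below \<open>d\<close>, so locality of
  \<open>P\<close> follows from the syntax. This is what allows the values of later variables to be
  changed at will.\<close>

lemma prefix_definable_agree:
  assumes "prefix_definable n d Q P" "w \<in> strings n" "range e \<subseteq> {1..n}" "range e' \<subseteq> {1..n}"
    and "\<And>x. x < d \<Longrightarrow> e x = e' x"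
  shows "P w e \<longleftrightarrow> P w e'"
proof -
  obtain \<phi> where "free_vars \<phi> \<subseteq> {..<d}"
    and sat: "\<forall>w\<in>strings n. \<forall>e. range e \<subseteq> {1..n} \<longrightarrow> (sat (string_struct w) e \<phi> \<longleftrightarrow> P w e)"
    using prefix_definable_formula[OF assms(1)] by blast
  then have "sat (string_struct w) e \<phi> = sat (string_struct w) e' \<phi>"
    using assms(5) by (intro sat_cong) auto
  with sat assms show ?thesis by blast
qed

lemma prefix_definable_cong:
  assumes "prefix_definable n d Q P"
    and "\<And>w e. w \<in> strings n \<Longrightarrow> range e \<subseteq> {1..n} \<Longrightarrow> P w e \<longleftrightarrow> P' w e"
  shows "prefix_definable n d Q P'"
  using assms by (cases Q) auto

section \<open>Closure properties of quantifier-free definability\<close>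

lemma qf_neg: "prefix_definable n d [] P \<Longrightarrow> prefix_definable n d [] (\<lambda>w e. \<not> P w e)"
  by (clarsimp, rule_tac x = "Neg \<phi>" in exI) simp

lemma qf_conj:
  assumes "prefix_definable n d [] P" "prefix_definable n d [] P'"
  shows "prefix_definable n d [] (\<lambda>w e. P w e \<and> P' w e)"
  using assms by (clarsimp, rule_tac x = "Conj \<phi> \<phi>'" in exI) simp

lemma qf_disj:
  assumes "prefix_definable n d [] P" "prefix_definable n d [] P'"
  shows "prefix_definable n d [] (\<lambda>w e. P w e \<or> P' w e)"
  using assms by (clarsimp, rule_tac x = "Disj \<phi> \<phi>'" in exI) simp

lemma qf_const: "prefix_definable n d [] (\<lambda>w e. b)"
  by (simp, rule exI[of _ "if b then Eq MinC MinC else Neg (Eq MinC MinC)"]) simp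

lemma qf_imp:
  assumes "prefix_definable n d [] P" "prefix_definable n d [] P'"
  shows "prefix_definable n d [] (\<lambda>w e. P w e \<longrightarrow> P' w e)"
  using qf_disj[OF qf_neg[OF assms(1)] assms(2)] by (rule prefix_definable_cong) auto

lemma qf_iff_const:
  assumes "prefix_definable n d [] P"
  shows "prefix_definable n d [] (\<lambda>w e. P w e \<longleftrightarrow> b)"
  using assms qf_neg[OF assms] by (cases b) (auto simp del: prefix_definable.simps)

lemma qf_ball:
  assumes "finite I" "\<And>i. i \<in> I \<Longrightarrow> prefix_definable n d [] (P i)"
  shows "prefix_definable n d [] (\<lambda>w e. \<forall>i\<in>I. P i w e)"
  using assms
proof (induction I rule: finite_induct)
  case empty
  show ?case using qf_const[of n d True] by (simp del: prefix_definable.simps)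
next
  case (insert i I)
  then show ?case by (simp only: ball_simps) (intro qf_conj; simp del: prefix_definable.simps)
qed

lemma qf_bex:
  assumes "finite I" "\<And>i. i \<in> I \<Longrightarrow> prefix_definable n d [] (P i)"
  shows "prefix_definable n d [] (\<lambda>w e. \<exists>i\<in>I. P i w e)"
proof -
  have "prefix_definable n d [] (\<lambda>w e. \<not> (\<forall>i\<in>I. \<not> P i w e))"
    using assms by (intro qf_neg qf_ball)
  then show ?thesis by (simp del: prefix_definable.simps)
qed

text \<open>Needed because \<open>less_rel\<close> contains pairs of positions only, so atoms
  express the order of numbers only for terms that denote positions.\<close>

lemma trm_val_in:
  assumes "w \<in> strings n" "range e \<subseteq> {1..n}" "n \<ge> 1"
  shows "trm_val (string_struct w) e t \<in> {1..n}"
  using assms range_subsetD[OF assms(2)] string_struct_simps(4,5)[OF assms(1)]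
  by (cases t) (simp_all del: One_nat_def)

lemma qf_less:
  assumes "trm_vars s \<subseteq> {..<d}" "trm_vars t \<subseteq> {..<d}" "n \<ge> 1"
  shows "prefix_definable n d []
    (\<lambda>w e. trm_val (string_struct w) e s < trm_val (string_struct w) e t)"
  using assms trm_val_in[OF _ _ assms(3)]
  by (simp, intro exI[of _ "Less s t"]) (auto simp: string_struct_simps)

lemma qf_eq:
  assumes "trm_vars s \<subseteq> {..<d}" "trm_vars t \<subseteq> {..<d}"
  shows "prefix_definable n d []
    (\<lambda>w e. trm_val (string_struct w) e s = trm_val (string_struct w) e t)"
  using assms by (simp, intro exI[of _ "Eq s t"]) auto

lemma qf_le:
  assumes "trm_vars s \<subseteq> {..<d}" "trm_vars t \<subseteq> {..<d}" "n \<ge> 1"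
  shows "prefix_definable n d []
    (\<lambda>w e. trm_val (string_struct w) e s \<le> trm_val (string_struct w) e t)"
  unfolding le_less by (intro qf_disj qf_less qf_eq assms)

lemma qf_letter:
  assumes "v < d"
  shows "prefix_definable n d [] (\<lambda>w e. w ! (e v - 1))"
proof -
  have "sat (string_struct w) e (S (Var v)) \<longleftrightarrow> w ! (e v - 1)"
    if "w \<in> strings n" "range e \<subseteq> {1..n}" for w e
    using range_subsetD[OF that(2), of v] string_struct_simps(3)[OF that(1)] by simp
  then show ?thesis
    using assms by (simp del: sat.simps, intro exI[of _ "S (Var v)"]) simp
qed

lemma qf_var_less:
  assumes "u < d" "v < d" "n \<ge> 1"
  shows "prefix_definable n d [] (\<lambda>w e. e u < e v)"
  using qf_less[of "Var u" d "Var v" n] assms by (simp del: prefix_definable.simps)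

lemma qf_var_eq:
  assumes "u < d" "v < d"
  shows "prefix_definable n d [] (\<lambda>w e. e u = e v)"
  using qf_eq[of "Var u" d "Var v" n] assms by (simp del: prefix_definable.simps)

section \<open>Case distinctions and announced choices under a shared prefix\<close>

lemma prefix_definable_const:
  assumes "n \<ge> 1"
  shows "prefix_definable n d Q (\<lambda>w e. b)"
proof (induction Q arbitrary: d)
  case Nil
  show ?case by (rule qf_const)
next
  case (Cons q Q)
  \<comment> \<open>A vacuous existential quantifier preserves truth, and a vacuous universal one
    falsity, only over a nonempty universe; hence \<open>n \<ge> 1\<close>.\<close>
  show ?case
    using Cons.IH[of "Suc d"] assms by (simp, intro exI[of _ "\<lambda>w e. b"]) auto
qed

text \<open>The guard does not mention the variables bound by the prefix, so it can be moved inside past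
  quantifiers of either kind: both branches share one prefix.\<close>

lemma prefix_definable_if:
  assumes "prefix_definable n d [] G" "prefix_definable n d Q P" "prefix_definable n d Q P'"
  shows "prefix_definable n d Q (\<lambda>w e. if G w e then P w e else P' w e)"
  using assms
proof (induction Q arbitrary: d P P')
  case Nil
  have "prefix_definable n d [] (\<lambda>w e. (G w e \<longrightarrow> P w e) \<and> (\<not> G w e \<longrightarrow> P' w e))"
    using Nil by (intro qf_conj qf_imp qf_neg)
  then show ?case by (rule prefix_definable_cong) auto
next
  case (Cons q Q)
  obtain R where R: "prefix_definable n (Suc d) Q R"
    and P: "\<And>w e. w \<in> strings n \<Longrightarrow> range e \<subseteq> {1..n} \<Longrightarrow>
      P w e \<longleftrightarrow> (if q then \<exists>a\<in>{1..n}. R w (e(d := a)) else \<forall>a\<in>{1..n}. R w (e(d := a)))"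
    using Cons.prems(2) by auto
  obtain R' where R': "prefix_definable n (Suc d) Q R'"
    and P': "\<And>w e. w \<in> strings n \<Longrightarrow> range e \<subseteq> {1..n} \<Longrightarrow>
      P' w e \<longleftrightarrow> (if q then \<exists>a\<in>{1..n}. R' w (e(d := a)) else \<forall>a\<in>{1..n}. R' w (e(d := a)))"
    using Cons.prems(3) by auto
  have "prefix_definable n (Suc d) [] G"
    using Cons.prems(1) by (fastforce simp: subset_iff less_Suc_eq)
  then have R'': "prefix_definable n (Suc d) Q (\<lambda>w e. if G w e then R w e else R' w e)"
    by (rule Cons.IH[OF _ R R'])
  have G: "G w (e(d := a)) \<longleftrightarrow> G w e"
    if "w \<in> strings n" "range e \<subseteq> {1..n}" "a \<in> {1..n}" for w e a
    using that by (intro prefix_definable_agree[OF Cons.prems(1)]) auto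
  show ?case
  proof (cases q)
    case True
    have "prefix_definable n d (True # Q) (\<lambda>w e. if G w e then P w e else P' w e)"
      by (rule prefix_definable_Ex[OF R'']) (simp add: P P' G True del: One_nat_def)
    then show ?thesis using True by (simp only:)
  next
    case False
    have "prefix_definable n d (False # Q) (\<lambda>w e. if G w e then P w e else P' w e)"
      by (rule prefix_definable_All[OF R'']) (simp add: P P' G False del: One_nat_def)
    then show ?thesis using False by (simp only:)
  qed
qed

text \<open>Exclusive guards turn the disjunction into an iterated \<open>if\<close>: once
  \<open>G i\<close> holds, no other disjunct can be true, so nothing is lost by looking at
  \<open>P i\<close> alone.\<close>

lemma prefix_definable_cases:
  assumes "n \<ge> 1" "finite I"
    and "\<And>i. i \<in> I \<Longrightarrow> prefix_definable n d [] (G i)"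
    and "\<And>i. i \<in> I \<Longrightarrow> prefix_definable n d Q (P i)"
    and "\<And>i j w e. i \<in> I \<Longrightarrow> j \<in> I \<Longrightarrow> G i w e \<Longrightarrow> G j w e \<Longrightarrow> i = j"
  shows "prefix_definable n d Q (\<lambda>w e. \<exists>i\<in>I. G i w e \<and> P i w e)"
  using assms(2-)
proof (induction I rule: finite_induct)
  case empty
  show ?case using prefix_definable_const[OF assms(1), of d Q False] by simp
next
  case (insert i I)
  have "prefix_definable n d Q (\<lambda>w e. \<exists>i\<in>I. G i w e \<and> P i w e)"
    using insert.prems by (intro insert.IH) auto
  then have "prefix_definable n d Q
      (\<lambda>w e. if G i w e then P i w e else \<exists>i\<in>I. G i w e \<and> P i w e)"
    using insert.prems by (intro prefix_definable_if) auto
  then show ?case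
    by (rule prefix_definable_cong) (metis insert.prems(3) insert.hyps(2) insert_iff)
qed

text \<open>Treats a block of existential quantifiers at once. The new assignment may differ from
  the old one at all levels from \<open>d\<close> on, since \<open>R\<close> ignores those beyond
  the block.\<close>

lemma prefix_definable_exists:
  assumes "prefix_definable n (d + k) Q R"
    and "\<And>w e. w \<in> strings n \<Longrightarrow> range e \<subseteq> {1..n} \<Longrightarrow>
      P w e \<longleftrightarrow> (\<exists>e'. range e' \<subseteq> {1..n} \<and> (\<forall>x<d. e' x = e x) \<and> R w e')"
  shows "prefix_definable n d (replicate k True @ Q) P"
  using assms
proof (induction k arbitrary: d P)
  case 0
  have "R w e \<longleftrightarrow> P w e" if "w \<in> strings n" "range e \<subseteq> {1..n}" for w e
  proof -
    have "R w e' \<longleftrightarrow> R w e" if "range e' \<subseteq> {1..n}" "\<forall>x<d. e' x = e x" for e'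
      using that \<open>range e \<subseteq> {1..n}\<close> by (intro prefix_definable_agree[OF 0(1) \<open>w \<in> strings n\<close>]) auto
    then show ?thesis
      using 0(2)[OF that] that(2) by blast
  qed
  with 0(1) show ?case
    unfolding replicate_0 append_Nil add_0_right by (rule prefix_definable_cong)
next
  case (Suc k)
  let ?P = "\<lambda>w e. \<exists>e'. range e' \<subseteq> {1..n} \<and> (\<forall>x<Suc d. e' x = e x) \<and> R w e'"
  have "prefix_definable n (Suc d) (replicate k True @ Q) ?P"
    using Suc.prems(1) by (intro Suc.IH) auto
  then have "prefix_definable n d (True # replicate k True @ Q) P"
  proof (rule prefix_definable_Ex)
    fix w and e :: "nat \<Rightarrow> nat"
    assume w: "w \<in> strings n" and e: "range e \<subseteq> {1..n}"
    show "P w e \<longleftrightarrow> (\<exists>a\<in>{1..n}. ?P w (e(d := a)))"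
    proof
      assume "P w e"
      then obtain e' where "range e' \<subseteq> {1..n}" "\<forall>x<d. e' x = e x" "R w e'"
        using Suc.prems(2)[OF w e] by blast
      then have "?P w (e(d := e' d))" by (auto simp: less_Suc_eq)
      then show "\<exists>a\<in>{1..n}. ?P w (e(d := a))"
        using range_subsetD[OF \<open>range e' \<subseteq> {1..n}\<close>] by blast
    next
      assume "\<exists>a\<in>{1..n}. ?P w (e(d := a))"
      then show "P w e"
        unfolding Suc.prems(2)[OF w e] by (metis fun_upd_other less_SucI less_irrefl)
    qed
  qed
  then show ?case by simp
qed

text \<open>The equality pattern of \<open>m\<close> variables with \<open>t\<close> distinct marked positions takes \<open>t ^ m\<close>
  values, so it can announce the chosen index \<open>j\<close> to the matrix.\<close>

lemma prefix_definable_choice: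
  assumes "1 \<le> n" "t \<le> n" "finite J" "card J \<le> t ^ m"
    and def: "\<And>j d'. j \<in> J \<Longrightarrow> d \<le> d' \<Longrightarrow> prefix_definable n d' Q (P j)"
  shows "prefix_definable n d (replicate (t + m) True @ Q) (\<lambda>w e. \<exists>j\<in>J. P j w e)"
proof -
  \<comment> \<open>Each \<open>j\<close> gets a code word \<open>h j\<close> of length
    \<open>m\<close> over an alphabet of \<open>t\<close> marks.\<close>
  have "card J \<le> card ({..<m} \<rightarrow>\<^sub>E {..<t})"
    using assms(4) by (simp add: card_funcsetE)
  then obtain h where h: "h ` J \<subseteq> {..<m} \<rightarrow>\<^sub>E {..<t}" "inj_on h J"
    using card_le_inj[OF assms(3), of "{..<m} \<rightarrow>\<^sub>E {..<t}"] by (auto simp: finite_PiE)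
  have ht: "h j i < t" if "j \<in> J" "i < m" for j i
    using h(1) that by (auto simp: PiE_iff image_subset_iff)
  \<comment> \<open>Levels \<open>d\<close> to \<open>d + t - 1\<close> hold the marks, the next
    \<open>m\<close> levels spell the code word of \<open>j\<close>. As the marks are distinct, the
    word can be read off, so different \<open>j\<close> have exclusive guards.\<close>
  define G :: "'a \<Rightarrow> bool list \<Rightarrow> (nat \<Rightarrow> nat) \<Rightarrow> bool" where
    "G j w e \<longleftrightarrow> (\<forall>i\<in>{..<t}. \<forall>i'\<in>{..<t}. i \<noteq> i' \<longrightarrow> e (d + i) \<noteq> e (d + i')) \<and>
      (\<forall>i\<in>{..<m}. e (d + t + i) = e (d + h j i))" for j w e
  have "prefix_definable n (d + (t + m)) [] (G j)" if "j \<in> J" for j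
    unfolding G_def using ht[OF that]
    by (intro qf_conj qf_ball qf_imp qf_neg qf_const qf_var_eq) (auto intro: trans_less_add1)
  moreover have "j = j'" if "j \<in> J" "j' \<in> J" "G j w e" "G j' w e" for j j' w e
  proof (rule inj_onD[OF h(2) _ that(1,2)], rule PiE_ext)
    show "h j \<in> {..<m} \<rightarrow>\<^sub>E {..<t}" "h j' \<in> {..<m} \<rightarrow>\<^sub>E {..<t}"
      using h(1) that by auto
    show "h j i = h j' i" if "i \<in> {..<m}" for i
      using \<open>G j w e\<close> \<open>G j' w e\<close> ht[OF \<open>j \<in> J\<close>] ht[OF \<open>j' \<in> J\<close>] that
      unfolding G_def by (metis lessThan_iff)
  qed
  \<comment> \<open>\<open>def\<close> is used at this deeper scope here, and at scope
    \<open>d\<close> below to see that \<open>P j\<close> does not depend on the new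
    variables.\<close>
  ultimately have "prefix_definable n (d + (t + m)) Q (\<lambda>w e. \<exists>j\<in>J. G j w e \<and> P j w e)"
    using def by (intro prefix_definable_cases assms) auto
  then show ?thesis
  proof (rule prefix_definable_exists)
    fix w and e :: "nat \<Rightarrow> nat" assume w: "w \<in> strings n" and e: "range e \<subseteq> {1..n}"
    show "(\<exists>j\<in>J. P j w e) \<longleftrightarrow>
      (\<exists>e'. range e' \<subseteq> {1..n} \<and> (\<forall>x<d. e' x = e x) \<and> (\<exists>j\<in>J. G j w e' \<and> P j w e'))"
    proof
      assume "\<exists>j\<in>J. P j w e"
      then obtain j where j: "j \<in> J" "P j w e" by blast
      \<comment> \<open>The marks are placed on the positions 1 to \<open>t\<close>, which exist by
        \<open>t \<le> n\<close>; the final 1 only keeps the range within the universe.\<close>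
      define e' where "e' x = (if x < d then e x else if x < d + t then Suc (x - d)
        else if x < d + t + m then Suc (h j (x - d - t)) else 1)" for x
      have e': "range e' \<subseteq> {1..n}"
      proof (rule image_subsetI)
        fix x
        have "h j (x - d - t) < t" if "\<not> x < d + t" "x < d + t + m"
          using that by (intro ht j) auto
        then show "e' x \<in> {1..n}"
          unfolding e'_def using range_subsetD[OF e, of x] assms(1,2) by auto
      qed
      have "P j w e'"
        using j(2) prefix_definable_agree[OF def[OF j(1) order_refl] w e e'] by (simp add: e'_def)
      moreover have "G j w e'"
        using ht[OF j(1)] by (auto simp: G_def e'_def)
      ultimately show
        "\<exists>e'. range e' \<subseteq> {1..n} \<and> (\<forall>x<d. e' x = e x) \<and> (\<exists>j\<in>J. G j w e' \<and> P j w e')"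
        using j(1) e' by (intro exI[of _ e']) (auto simp: e'_def)
    next
      assume "\<exists>e'. range e' \<subseteq> {1..n} \<and> (\<forall>x<d. e' x = e x) \<and> (\<exists>j\<in>J. G j w e' \<and> P j w e')"
      then show "\<exists>j\<in>J. P j w e"
        using prefix_definable_agree[OF def[OF _ order_refl] w e] by metis
    qed
  qed
qed

section \<open>Distances and positions\<close>

primrec alternating :: "bool \<Rightarrow> nat \<Rightarrow> bool list" where
  "alternating q 0 = []"
| "alternating q (Suc r) = q # alternating (\<not> q) r"

lemma length_alternating: "length (alternating q r) = r"
  by (induction r arbitrary: q) auto

text \<open>The bounds are strict, so \<open>a\<close> and \<open>b\<close> bound the numbers of
  positions in the closed intervals from \<open>p\<close> to \<open>x\<close> and from
  \<open>x\<close> to \<open>q\<close>. A bound 0 can never be met.\<close>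

definition both_short :: "nat \<Rightarrow> nat \<Rightarrow> nat \<Rightarrow> nat \<Rightarrow> nat \<Rightarrow> bool" where
  "both_short p a x b q \<longleftrightarrow> p \<le> x \<and> x \<le> q \<and> (x < p + a \<and> q < x + b)"

definition one_short :: "nat \<Rightarrow> nat \<Rightarrow> nat \<Rightarrow> nat \<Rightarrow> nat \<Rightarrow> bool" where
  "one_short p a x b q \<longleftrightarrow> p \<le> x \<and> x \<le> q \<and> (x < p + a \<or> q < x + b)"

text \<open>The two halves add up to \<open>a\<close>. If the interval is too long, the point
  \<open>p + Suc a div 2\<close> lies in it and leaves both parts too long.\<close>

lemma short_iff_forall_split:
  assumes "p \<le> x"
  shows "x < p + a \<longleftrightarrow> (\<forall>y\<in>{p..x}. one_short p (Suc a div 2) y (a div 2) x)"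
proof
  assume "x < p + a"
  then show "\<forall>y\<in>{p..x}. one_short p (Suc a div 2) y (a div 2) x"
    by (auto simp: one_short_def)
next
  assume *: "\<forall>y\<in>{p..x}. one_short p (Suc a div 2) y (a div 2) x"
  show "x < p + a"
  proof (rule ccontr)
    assume "\<not> x < p + a"
    then show False
      using bspec[OF *, of "p + Suc a div 2"] by (simp add: one_short_def) linarith
  qed
qed

text \<open>Adding two strict bounds gains one unit, so the bounds of the parts may add up to
  \<open>a + 1\<close>. The witness lies \<open>a div 2\<close> beyond \<open>p\<close>, or at
  \<open>x\<close> if that comes first.\<close>

lemma short_iff_exists_split:
  assumes "p \<le> x"
  shows "x < p + a \<longleftrightarrow> (\<exists>y\<in>{p..x}. both_short p (Suc (a div 2)) y (Suc a div 2) x)"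
proof
  assume "x < p + a"
  then show "\<exists>y\<in>{p..x}. both_short p (Suc (a div 2)) y (Suc a div 2) x"
    using assms by (intro bexI[of _ "min x (p + a div 2)"]) (auto simp: both_short_def)
next
  assume "\<exists>y\<in>{p..x}. both_short p (Suc (a div 2)) y (Suc a div 2) x"
  then show "x < p + a"
    by (auto simp: both_short_def)
qed

text \<open>Here a quantifier is saved: one universal quantifier serves a conjunction of two claims,
  one existential quantifier a disjunction.\<close>

lemma bounded_quantifier_split:
  fixes p x q n :: nat
  assumes "1 \<le> p" "p \<le> x" "x \<le> q" "q \<le> n"
  shows "(\<forall>y\<in>{1..n}. if p \<le> y \<and> y \<le> x then A y else if x \<le> y \<and> y \<le> q then B y else True) \<longleftrightarrow>
      (\<forall>y\<in>{p..x}. A y) \<and> (\<forall>y\<in>{x<..q}. B y)" (is ?forall)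
    and "(\<exists>y\<in>{1..n}. if p \<le> y \<and> y \<le> x then A y else if x \<le> y \<and> y \<le> q then B y else False) \<longleftrightarrow>
      (\<exists>y\<in>{p..x}. A y) \<or> (\<exists>y\<in>{x<..q}. B y)" (is ?exists)
proof -
  have sub: "{p..x} \<subseteq> {1..n}" "{x<..q} \<subseteq> {1..n}" using assms by auto
  have "(if p \<le> y \<and> y \<le> x then A y else if x \<le> y \<and> y \<le> q then B y else True) \<longleftrightarrow>
      (y \<in> {p..x} \<longrightarrow> A y) \<and> (y \<in> {x<..q} \<longrightarrow> B y)" for y
    using assms by auto
  with sub show ?forall by blast
  have "(if p \<le> y \<and> y \<le> x then A y else if x \<le> y \<and> y \<le> q then B y else False) \<longleftrightarrow>
      (y \<in> {p..x} \<and> A y) \<or> (y \<in> {x<..q} \<and> B y)" for y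
    using assms by auto
  with sub show ?exists by blast
qed

text \<open>In the next two lemmas the new point \<open>y\<close> must fall into one of two intervals, decided by an
  exclusive guard, so the common endpoint \<open>y = x\<close> is given to the left one. The extra conditions
  on \<open>b\<close> and \<open>x = q\<close> repair the right interval for that loss.\<close>

lemma both_short_iff:
  assumes "p \<in> {1..n}" "x \<in> {1..n}" "q \<in> {1..n}"
  shows "both_short p a x b q \<longleftrightarrow> (\<forall>y\<in>{1..n}.
    if p \<le> x \<and> x \<le> q \<and> 0 < b then
      if p \<le> y \<and> y \<le> x then one_short p (Suc a div 2) y (a div 2) x
      else if x \<le> y \<and> y \<le> q then one_short x (Suc b div 2) y (b div 2) q
      else True
    else False)" (is "_ \<longleftrightarrow> (\<forall>y\<in>_. ?R y)")
proof (cases "p \<le> x \<and> x \<le> q \<and> 0 < b")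
  case True
  \<comment> \<open>At the lost endpoint the first part is a single point, and
    \<open>Suc b div 2\<close> is positive.\<close>
  have "one_short x (Suc b div 2) x (b div 2) q"
    using True by (auto simp: one_short_def)
  then have "(\<forall>y\<in>{x..q}. one_short x (Suc b div 2) y (b div 2) q) \<longleftrightarrow>
      (\<forall>y\<in>{x<..q}. one_short x (Suc b div 2) y (b div 2) q)"
    by (metis atLeastAtMost_iff greaterThanAtMost_iff le_eq_less_or_eq)
  moreover have "(\<forall>y\<in>{1..n}. ?R y) \<longleftrightarrow>
      (\<forall>y\<in>{p..x}. one_short p (Suc a div 2) y (a div 2) x) \<and>
      (\<forall>y\<in>{x<..q}. one_short x (Suc b div 2) y (b div 2) q)"
    using True assms bounded_quantifier_split(1)[of p x q n] by (simp del: One_nat_def)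
  ultimately show ?thesis
    using True short_iff_forall_split[of p x a] short_iff_forall_split[of x q b]
    by (simp add: both_short_def)
next
  case False
  then show ?thesis
    using assms by (auto simp: both_short_def)
qed

lemma one_short_iff:
  assumes "p \<in> {1..n}" "x \<in> {1..n}" "q \<in> {1..n}"
  shows "one_short p a x b q \<longleftrightarrow> (\<exists>y\<in>{1..n}.
    if p \<le> x \<and> x \<le> q then
      if x = q \<and> 0 < b then True
      else if p \<le> y \<and> y \<le> x then both_short p (Suc (a div 2)) y (Suc a div 2) x
      else if x \<le> y \<and> y \<le> q then both_short x (Suc (b div 2)) y (Suc b div 2) q
      else False
    else False)" (is "_ \<longleftrightarrow> (\<exists>y\<in>_. ?R y)")
proof (cases "p \<le> x \<and> x \<le> q \<and> \<not> (x = q \<and> 0 < b)")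
  case True
  \<comment> \<open>A witness at the lost endpoint moves to \<open>Suc x\<close>: from
    \<open>x < q\<close> and \<open>q < x + Suc b div 2\<close> it follows that
    \<open>b div 2\<close> is positive, so the first part has room for one more position.\<close>
  have "\<exists>y\<in>{x<..q}. both_short x (Suc (b div 2)) y (Suc b div 2) q"
    if y: "both_short x (Suc (b div 2)) x (Suc b div 2) q"
  proof (rule bexI[of _ "Suc x"])
    have "q < x + Suc b div 2" using y by (simp add: both_short_def)
    moreover from this have "0 < b" by (rule contrapos_pp) (use True in auto)
    ultimately show "both_short x (Suc (b div 2)) (Suc x) (Suc b div 2) q" "Suc x \<in> {x<..q}"
      using True by (auto simp: both_short_def)
  qed
  then have "(\<exists>y\<in>{x..q}. both_short x (Suc (b div 2)) y (Suc b div 2) q) \<longleftrightarrow>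
      (\<exists>y\<in>{x<..q}. both_short x (Suc (b div 2)) y (Suc b div 2) q)"
    by (metis atLeastAtMost_iff greaterThanAtMost_iff le_eq_less_or_eq)
  moreover have "(\<exists>y\<in>{1..n}. ?R y) \<longleftrightarrow>
      (\<exists>y\<in>{p..x}. both_short p (Suc (a div 2)) y (Suc a div 2) x) \<or>
      (\<exists>y\<in>{x<..q}. both_short x (Suc (b div 2)) y (Suc b div 2) q)"
    using True assms bounded_quantifier_split(2)[of p x q n] by (simp del: One_nat_def)
  ultimately show ?thesis
    using True short_iff_exists_split[of p x a] short_iff_exists_split[of x q b]
    by (simp add: one_short_def)
next
  case False
  then show ?thesis
    using assms by (auto simp: one_short_def)
qed

lemma trm_val_upd:
  "trm_vars t \<subseteq> {..<d} \<Longrightarrow> trm_val M (e(d := a)) t = trm_val M e t"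
  by (rule trm_val_cong) auto

text \<open>The bounds \<open>8\<close> and \<open>10\<close> are the offsets for which the halving steps of the two mutually
  recursive statements close.\<close>

lemma both_short_one_short_definable:
  fixes p x q :: trm
  assumes "n \<ge> 1" "trm_vars p \<subseteq> {..<d}" "trm_vars x \<subseteq> {..<d}" "trm_vars q \<subseteq> {..<d}"
  shows "6 * a \<le> 2 ^ r + 10 \<Longrightarrow> 6 * b \<le> 2 ^ r + 10 \<Longrightarrow>
      prefix_definable n d (alternating False r) (\<lambda>w e.
        both_short (trm_val (string_struct w) e p) a (trm_val (string_struct w) e x) b
          (trm_val (string_struct w) e q))"
    and "6 * a \<le> 2 ^ r + 8 \<Longrightarrow> 6 * b \<le> 2 ^ r + 8 \<Longrightarrow>
      prefix_definable n d (alternating True r) (\<lambda>w e.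
        one_short (trm_val (string_struct w) e p) a (trm_val (string_struct w) e x) b
          (trm_val (string_struct w) e q))"
  using assms(2-)
proof (induction r arbitrary: d p x q a b)
  case 0
  note qfs = qf_conj qf_disj qf_const qf_le qf_eq assms(1)
  {
    case 1
    \<comment> \<open>Without quantifiers only the bounds 0 and 1 remain: 0 is unsatisfiable and 1
      means that the endpoints coincide.\<close>
    then have ab: "a \<in> {0, 1}" "b \<in> {0, 1}" by auto
    have "prefix_definable n d [] (\<lambda>w e.
        (trm_val (string_struct w) e p \<le> trm_val (string_struct w) e x \<and>
        trm_val (string_struct w) e x \<le> trm_val (string_struct w) e q) \<and>
        (a = 1 \<and> trm_val (string_struct w) e p = trm_val (string_struct w) e x) \<and>
        (b = 1 \<and> trm_val (string_struct w) e x = trm_val (string_struct w) e q))"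
      using 1 by (intro qfs)
    then show ?case
      unfolding alternating.simps
      by (rule prefix_definable_cong) (use ab in \<open>auto simp: both_short_def\<close>)
  next
    case 2
    then have ab: "a \<in> {0, 1}" "b \<in> {0, 1}" by auto
    have "prefix_definable n d [] (\<lambda>w e.
        (trm_val (string_struct w) e p \<le> trm_val (string_struct w) e x \<and>
        trm_val (string_struct w) e x \<le> trm_val (string_struct w) e q) \<and>
        ((a = 1 \<and> trm_val (string_struct w) e p = trm_val (string_struct w) e x) \<or>
        (b = 1 \<and> trm_val (string_struct w) e x = trm_val (string_struct w) e q)))"
      using 2 by (intro qfs)
    then show ?case
      unfolding alternating.simps
      by (rule prefix_definable_cong) (use ab in \<open>auto simp: one_short_def\<close>)
  }
next
  case (Suc r)
  let ?v = "\<lambda>w e t. trm_val (string_struct w) e t"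
  note ifs = prefix_definable_if prefix_definable_const qf_conj qf_const qf_le qf_eq assms(1)
  {
    case 1
    then have vars: "trm_vars p \<subseteq> {..<Suc d}" "trm_vars x \<subseteq> {..<Suc d}" "trm_vars q \<subseteq> {..<Suc d}"
      "trm_vars (Var d) \<subseteq> {..<Suc d}"
      by (auto simp: less_Suc_eq)
    have "prefix_definable n (Suc d) (alternating True r) (\<lambda>w e.
      if ?v w e p \<le> ?v w e x \<and> ?v w e x \<le> ?v w e q \<and> 0 < b then
        if ?v w e p \<le> ?v w e (Var d) \<and> ?v w e (Var d) \<le> ?v w e x then
          one_short (?v w e p) (Suc a div 2) (?v w e (Var d)) (a div 2) (?v w e x)
        else if ?v w e x \<le> ?v w e (Var d) \<and> ?v w e (Var d) \<le> ?v w e q then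
          one_short (?v w e x) (Suc b div 2) (?v w e (Var d)) (b div 2) (?v w e q)
        else True
      else False)" (is "prefix_definable _ _ _ ?R")
      \<comment> \<open>The larger half satisfies
        \<open>6 * (Suc a div 2) \<le> 3 * a + 3 \<le> 2 ^ r + 8\<close>.\<close>
      by (intro ifs vars Suc.IH(2)) (use 1(1,2) in auto)
    then show ?case
      unfolding alternating.simps not_False_eq_True
    proof (rule prefix_definable_All)
      fix w and e :: "nat \<Rightarrow> nat" assume that: "w \<in> strings n" "range e \<subseteq> {1..n}"
      show "both_short (?v w e p) a (?v w e x) b (?v w e q) \<longleftrightarrow>
        (\<forall>y\<in>{1..n}. ?R w (e(d := y)))"
        unfolding 1(3-5)[THEN trm_val_upd] trm_val.simps fun_upd_same
        by (intro both_short_iff trm_val_in that assms(1))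
    qed
  next
    case 2
    then have vars: "trm_vars p \<subseteq> {..<Suc d}" "trm_vars x \<subseteq> {..<Suc d}" "trm_vars q \<subseteq> {..<Suc d}"
      "trm_vars (Var d) \<subseteq> {..<Suc d}"
      by (auto simp: less_Suc_eq)
    have "prefix_definable n (Suc d) (alternating False r) (\<lambda>w e.
      if ?v w e p \<le> ?v w e x \<and> ?v w e x \<le> ?v w e q then
        if ?v w e x = ?v w e q \<and> 0 < b then True
        else if ?v w e p \<le> ?v w e (Var d) \<and> ?v w e (Var d) \<le> ?v w e x then
          both_short (?v w e p) (Suc (a div 2)) (?v w e (Var d)) (Suc a div 2) (?v w e x)
        else if ?v w e x \<le> ?v w e (Var d) \<and> ?v w e (Var d) \<le> ?v w e q then
          both_short (?v w e x) (Suc (b div 2)) (?v w e (Var d)) (Suc b div 2) (?v w e q)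
        else False
      else False)" (is "prefix_definable _ _ _ ?R")
      \<comment> \<open>The larger bound satisfies
        \<open>6 * Suc (a div 2) \<le> 3 * a + 6 \<le> 2 ^ r + 10\<close>.\<close>
      by (intro ifs vars Suc.IH(1)) (use 2(1,2) in auto)
    then show ?case
      unfolding alternating.simps not_True_eq_False
    proof (rule prefix_definable_Ex)
      fix w and e :: "nat \<Rightarrow> nat" assume that: "w \<in> strings n" "range e \<subseteq> {1..n}"
      show "one_short (?v w e p) a (?v w e x) b (?v w e q) \<longleftrightarrow>
        (\<exists>y\<in>{1..n}. ?R w (e(d := y)))"
        unfolding 2(3-5)[THEN trm_val_upd] trm_val.simps fun_upd_same
        by (intro one_short_iff trm_val_in that assms(1))
    qed
  }
qed

text \<open>Taking the first and last positions as \<open>p\<close> and \<open>q\<close>, the bounds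
  \<open>i\<close> and \<open>Suc n - i\<close> say that \<open>e v\<close> is at most
  \<open>i\<close> and at least \<open>i\<close>.\<close>

lemma position_definable:
  assumes "i \<in> {1..n}" "v < d" "6 * n \<le> 2 ^ r"
  shows "prefix_definable n d (alternating False r) (\<lambda>w e. e v = i)"
proof -
  have "prefix_definable n d (alternating False r) (\<lambda>w e.
      both_short (trm_val (string_struct w) e MinC) i (trm_val (string_struct w) e (Var v))
        (Suc n - i) (trm_val (string_struct w) e MaxC))"
    using assms by (intro both_short_one_short_definable(1)) auto
  then show ?thesis
  proof (rule prefix_definable_cong)
    fix w and e :: "nat \<Rightarrow> nat" assume w: "w \<in> strings n" and e: "range e \<subseteq> {1..n}"
    show "both_short (trm_val (string_struct w) e MinC) i (trm_val (string_struct w) e (Var v))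
        (Suc n - i) (trm_val (string_struct w) e MaxC) \<longleftrightarrow> e v = i"
      using range_subsetD[OF e, of v] string_struct_simps(4,5)[OF w] assms(1)
      by (auto simp: both_short_def)
  qed
qed

section \<open>Sets of strings\<close>

lemma strings_eq_iff:
  assumes "w \<in> strings n" "u \<in> strings n"
  shows "w = u \<longleftrightarrow> (\<forall>x\<in>{1..n}. w ! (x - 1) = u ! (x - 1))"
proof
  assume "\<forall>x\<in>{1..n}. w ! (x - 1) = u ! (x - 1)"
  then have "w ! i = u ! i" if "i < n" for i
    using that by (auto dest: bspec[of _ _ "Suc i"])
  then show "w = u"
    using assms by (auto simp: strings_def intro: nth_equalityI)
qed auto

lemma finite_strings: "finite (strings n)"
  using finite_lists_length_eq[of "UNIV :: bool set" n] by (simp add: strings_def)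

lemma member_definable:
  assumes "1 \<le> n" "t \<le> n" "A \<subseteq> strings n" "card A \<le> t ^ m" "n \<le> t ^ m" "6 * n \<le> 2 ^ r"
  shows "prefix_definable n d
    (replicate (t + m) True @ False # replicate (t + m) True @ alternating False r)
    (\<lambda>w e. w \<in> A)"
proof -
  \<comment> \<open>The letter test is a quantifier-free guard and adds no quantifier. The scope is
    arbitrary because \<open>prefix_definable_choice\<close> asks for definability at all deeper
    scopes.\<close>
  have letter: "prefix_definable n d (alternating False r)
      (\<lambda>w e. if w ! (e v - 1) \<longleftrightarrow> u ! (i - 1) then e v = i else False)"
    if "i \<in> {1..n}" "v < d" for d u i v
    using that assms(1,6)
    by (intro prefix_definable_if prefix_definable_const position_definable qf_iff_const qf_letter)
  have string: "prefix_definable n d (False # replicate (t + m) True @ alternating False r)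
      (\<lambda>w e. w = u)" if u: "u \<in> A" for d u
  proof -
    \<comment> \<open>Only the \<open>i\<close> equal to \<open>e d\<close> can succeed, so this
      compares \<open>w\<close> and \<open>u\<close> at the position \<open>e d\<close>.\<close>
    let ?R = "\<lambda>w e. \<exists>i\<in>{1..n}. if w ! (e d - 1) \<longleftrightarrow> u ! (i - 1) then e d = i else False"
    have "prefix_definable n (Suc d) (replicate (t + m) True @ alternating False r) ?R"
      using assms by (intro prefix_definable_choice letter) auto
    then show ?thesis
    proof (rule prefix_definable_All)
      fix w and e :: "nat \<Rightarrow> nat"
      assume "w \<in> strings n"
      then show "w = u \<longleftrightarrow> (\<forall>x\<in>{1..n}. ?R w (e(d := x)))"
        using strings_eq_iff[of w n u] u assms(3) by auto
    qed
  qed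
  have "prefix_definable n d
      (replicate (t + m) True @ False # replicate (t + m) True @ alternating False r)
      (\<lambda>w e. \<exists>u\<in>A. w = u)"
    using assms finite_subset[OF assms(3) finite_strings]
    by (intro prefix_definable_choice string) auto
  then show ?thesis by simp
qed

text \<open>Strict growth gives \<open>Suc j \<le> e j\<close> by induction from below, and the
  matching upper bound by descending from the last index, whose value is at most
  \<open>n\<close>.\<close>

lemma increasing_positions:
  fixes e :: "nat \<Rightarrow> nat"
  assumes "range e \<subseteq> {1..n}" "\<forall>i\<in>{..<n}. \<forall>j\<in>{..<n}. i < j \<longrightarrow> e i < e j" "i < n"
  shows "e i = Suc i"
proof -
  have "Suc j \<le> e j" if "j < n" for j
    using that
  proof (induction j)
    case 0
    show ?case using range_subsetD[OF assms(1), of 0] by simp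
  next
    case (Suc j)
    then have "Suc j \<le> e j" "e j < e (Suc j)" using assms(2) by auto
    then show ?case by simp
  qed
  moreover have "e (n - Suc j) \<le> n - j" if "j < n" for j
    using that
  proof (induction j)
    case 0
    show ?case using range_subsetD[OF assms(1), of "n - 1"] by simp
  next
    case (Suc j)
    then have "e (n - Suc j) \<le> n - j" "e (n - Suc (Suc j)) < e (n - Suc j)" using assms(2) by auto
    then show ?case by simp
  qed
  from this[of "n - Suc i"] have "e i \<le> Suc i" using assms(3) by (simp add: Suc_diff_Suc)
  ultimately show ?thesis using assms(3) by (simp add: le_antisym)
qed

text \<open>Meant for the finitely many small \<open>n\<close>: the variables list all positions in
  order, and a quantifier-free matrix then reads the whole string.\<close>

lemma member_definable_length:
  assumes "1 \<le> n" "A \<subseteq> strings n"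
  shows "prefix_definable n 0 (replicate n True) (\<lambda>w e. w \<in> A)"
proof -
  let ?R = "\<lambda>w e. (\<forall>i\<in>{..<n}. \<forall>j\<in>{..<n}. i < j \<longrightarrow> e i < e j) \<and>
    (\<exists>u\<in>A. \<forall>i\<in>{..<n}. w ! (e i - 1) \<longleftrightarrow> u ! i)"
  have "prefix_definable n (0 + n) []
      (\<lambda>w e. \<forall>i\<in>{..<n}. \<forall>j\<in>{..<n}. i < j \<longrightarrow> e i < e j)"
    using assms(1) by (intro qf_ball qf_imp qf_const qf_var_less) simp_all
  moreover have "prefix_definable n (0 + n) []
      (\<lambda>w e. \<exists>u\<in>A. \<forall>i\<in>{..<n}. w ! (e i - 1) \<longleftrightarrow> u ! i)"
    by (intro qf_bex qf_ball qf_iff_const qf_letter finite_subset[OF assms(2) finite_strings])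
      simp_all
  ultimately have "prefix_definable n (0 + n) [] ?R"
    by (rule qf_conj)
  then have "prefix_definable n 0 (replicate n True @ []) (\<lambda>w e. w \<in> A)"
  proof (rule prefix_definable_exists)
    fix w and e :: "nat \<Rightarrow> nat" assume w: "w \<in> strings n" and "range e \<subseteq> {1..n}"
    show "w \<in> A \<longleftrightarrow> (\<exists>e'. range e' \<subseteq> {1..n} \<and> (\<forall>x<0. e' x = e x) \<and> ?R w e')"
    proof
      assume "w \<in> A"
      let ?e = "\<lambda>i. if i < n then Suc i else 1"
      have "range ?e \<subseteq> {1..n}"
        using assms(1) by auto
      moreover have "?R w ?e"
        using \<open>w \<in> A\<close> by (intro conjI bexI[of _ w]) auto
      ultimately show "\<exists>e'. range e' \<subseteq> {1..n} \<and> (\<forall>x<0. e' x = e x) \<and> ?R w e'"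
        by (intro exI[of _ ?e]) simp
    next
      assume "\<exists>e'. range e' \<subseteq> {1..n} \<and> (\<forall>x<0. e' x = e x) \<and> ?R w e'"
      then obtain e' where e': "range e' \<subseteq> {1..n}" and R: "?R w e'"
        by (elim exE conjE) (rule that, assumption, rule conjI)
      note increasing = increasing_positions[OF e' conjunct1[OF R]]
      from conjunct2[OF R] obtain u where u: "u \<in> A" "\<forall>i\<in>{..<n}. w ! (e' i - 1) \<longleftrightarrow> u ! i"
        by (rule bexE)
      have "w ! i \<longleftrightarrow> u ! i" if "i < n" for i
        using bspec[OF u(2), of i] increasing[OF that] that by simp
      moreover have "length w = n" "length u = n"
        using w u(1) assms(2) by (auto simp: strings_def)
      ultimately have "w = u"
        by (intro nth_equalityI) auto
      with u(1) show "w \<in> A" by simp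
    qed
  qed
  then show ?thesis by simp
qed

section \<open>Sentences and the choice of the constants\<close>

lemma sentence_of_prefix_definable:
  assumes "1 \<le> n" "A \<subseteq> strings n" "prefix_definable n 0 Q (\<lambda>w e. w \<in> A)"
  shows "\<exists>\<phi>. sentence \<phi> \<and> quantifiers \<phi> = length Q \<and>
    (\<forall>w\<in>A. true_in (string_struct w) \<phi>) \<and> (\<forall>w\<in>strings n - A. \<not> true_in (string_struct w) \<phi>)"
proof -
  obtain \<phi> where \<phi>: "quantifiers \<phi> = length Q" "free_vars \<phi> \<subseteq> {..<0}"
    "\<forall>w\<in>strings n. \<forall>e. range e \<subseteq> {1..n} \<longrightarrow> (sat (string_struct w) e \<phi> \<longleftrightarrow> w \<in> A)"
    using prefix_definable_formula[OF assms(3)] by blast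
  have "true_in (string_struct w) \<phi> \<longleftrightarrow> w \<in> A" if "w \<in> strings n" for w
  proof -
    \<comment> \<open>Some assignment into the universe must exist, as otherwise
      \<open>true_in\<close> would hold vacuously.\<close>
    have "range (\<lambda>x :: nat. 1 :: nat) \<subseteq> {1..n}" using assms(1) by auto
    then show ?thesis
      unfolding true_in_def string_struct_simps(1)[OF that] using \<phi>(3) that by blast
  qed
  with \<phi> assms(2) show ?thesis
    unfolding sentence_def by (intro exI[of _ \<phi>]) auto
qed

theorem theorem5p4:
  fixes f :: "nat \<Rightarrow> nat" and k :: nat and \<epsilon> :: real
  assumes "filterlim f at_top at_top"
    and "(\<lambda>n. real (f n)) \<in> O(\<lambda>n. real n ^ k)"
    and "\<epsilon> > 0"
  shows "\<exists>C :: real. \<forall>n \<ge> 1. \<forall>A \<subseteq> strings n. card A = f n \<longrightarrow>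
    (\<exists>\<phi>. sentence \<phi> \<and>
      real (quantifiers \<phi>) \<le> (1 + \<epsilon>) * log 2 (real n) + C \<and>
      (\<forall>w \<in> A. true_in (string_struct w) \<phi>) \<and>
      (\<forall>w \<in> strings n - A. \<not> true_in (string_struct w) \<phi>))"
proof -
  obtain c where c: "c > 0" "eventually (\<lambda>n. norm (real (f n)) \<le> c * norm (real n ^ k)) at_top"
    using landau_o.bigE[OF assms(2)] by blast
  \<comment> \<open>One additional factor \<open>n\<close> absorbs the constant \<open>c\<close> as
    soon as \<open>n \<ge> c\<close>.\<close>
  have "eventually (\<lambda>n. f n \<le> n ^ Suc k) at_top"
    using c(2) eventually_ge_at_top[of "nat \<lceil>c\<rceil>"]
  proof eventually_elim
    case (elim n)
    have "c * real n ^ k \<le> real n * real n ^ k"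
      using elim(2) by (intro mult_right_mono) (linarith, simp)
    with elim(1) have "real (f n) \<le> real (n ^ Suc k)" by simp
    then show ?case by (simp only: of_nat_le_iff)
  qed
  then obtain N where N: "\<And>n. n \<ge> N \<Longrightarrow> f n \<le> n ^ Suc k"
    by (auto simp: eventually_at_top_linorder)
  \<comment> \<open>Chosen so that \<open>s * (\<epsilon> / 2) \<ge> k + 1\<close>; then
    \<open>m \<ge> \<epsilon> / 2 * log 2 n\<close> gives
    \<open>t ^ m = 2 ^ (s * m) \<ge> n ^ (k + 1)\<close>.\<close>
  define s where "s = nat \<lceil>2 * (real k + 1) / \<epsilon>\<rceil>"
  define t where "t = (2::nat) ^ s"
  \<comment> \<open>\<open>N + t\<close> pays for small \<open>n\<close>. For large \<open>n\<close>
    the two announcements cost \<open>2 * t\<close> and 2 for rounding \<open>m\<close> twice, the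
    quantifier over positions 1, and the distances 3 for \<open>log 2 6\<close> plus 1 for rounding
    \<open>r\<close>.\<close>
  define C where "C = real (N + t) + 2 * real t + 7"
  show ?thesis
  proof (intro exI[of _ C] allI impI)
    fix n A assume n: "1 \<le> n" and A: "A \<subseteq> strings n" and card: "card A = f n"
    let ?L = "log 2 (real n)"
    have L: "?L \<ge> 0" using n by simp
    have "\<exists>Q. prefix_definable n 0 Q (\<lambda>w e. w \<in> A) \<and> real (length Q) \<le> (1 + \<epsilon>) * ?L + C"
    proof (cases "n < N + t")
      case True
      have "real (length (replicate n True)) \<le> (1 + \<epsilon>) * ?L + C"
        using True L assms(3) by (simp add: C_def add_increasing)
      then show ?thesis using member_definable_length[OF n A] by blast
    next
      case False
      \<comment> \<open>Two announcements are made, so each may use half of \<epsilon>.\<close>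
      define m where "m = nat \<lceil>\<epsilon> / 2 * ?L\<rceil>"
      define r where "r = nat \<lceil>log 2 (6 * real n)\<rceil>"
      have "real n powr (real k + 1) \<le> real t ^ m"
      proof -
        have "(real k + 1) * ?L = (2 * (real k + 1) / \<epsilon>) * (\<epsilon> / 2 * ?L)"
          using assms(3) by simp
        also have "\<dots> \<le> real s * real m"
          using L assms(3) unfolding s_def m_def
          by (intro mult_mono' real_nat_ceiling_ge) auto
        finally have "2 powr ((real k + 1) * ?L) \<le> 2 powr (real s * real m)" by simp
        moreover have "2 powr ((real k + 1) * ?L) = (2 powr ?L) powr (real k + 1)"
          by (simp only: powr_powr mult.commute)
        moreover have "2 powr ?L = real n"
          using n by simp
        moreover have "2 powr (real s * real m) = real t ^ m"
          using powr_realpow[of 2 "s * m"] by (simp add: t_def power_mult)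
        ultimately show ?thesis by simp
      qed
      then have "real (n ^ Suc k) \<le> real (t ^ m)"
        using n powr_realpow[of "real n" "Suc k"] by (simp add: add.commute)
      then have tm: "n ^ Suc k \<le> t ^ m" by (simp only: of_nat_le_iff)
      have r: "6 * n \<le> 2 ^ r"
      proof -
        have "6 * real n = 2 powr (log 2 (6 * real n))" using n by simp
        also have "\<dots> \<le> 2 powr real r" unfolding r_def by (intro powr_mono real_nat_ceiling_ge) auto
        finally have "real (6 * n) \<le> real (2 ^ r)" by (simp add: powr_realpow)
        then show ?thesis by (simp only: of_nat_le_iff)
      qed
      let ?Q = "replicate (t + m) True @ False # replicate (t + m) True @ alternating False r"
      have "prefix_definable n 0 ?Q (\<lambda>w e. w \<in> A)"
      proof (rule member_definable[OF n _ A _ _ r])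
        show "t \<le> n" using False by simp
        show "card A \<le> t ^ m" using N[of n] False card tm by simp
        have "n \<le> n ^ Suc k" using n by simp
        then show "n \<le> t ^ m" using tm by (rule le_trans)
      qed
      moreover have "real (length ?Q) \<le> (1 + \<epsilon>) * ?L + C"
      proof -
        have "0 \<le> \<epsilon> / 2 * ?L" using L assms(3) by simp
        then have "real m \<le> \<epsilon> / 2 * ?L + 1"
          unfolding m_def by linarith
        moreover have "0 \<le> log 2 (6 * real n)" using n by simp
        then have "real r \<le> log 2 (6 * real n) + 1"
          unfolding r_def by linarith
        moreover have "log 2 (6 * real n) = log 2 6 + ?L" using n by (simp add: log_mult)
        moreover have "log 2 6 \<le> (3::real)"
          by (simp add: log_le_iff)
        moreover have "real (length ?Q) = 2 * real t + 2 * real m + 1 + real r"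
          by (simp add: length_alternating)
        moreover have "(1 + \<epsilon>) * ?L = ?L + 2 * (\<epsilon> / 2 * ?L)"
          by (simp add: distrib_right)
        ultimately show ?thesis
          unfolding C_def of_nat_add by linarith
      qed
      ultimately show ?thesis by blast
    qed
    then obtain Q where "prefix_definable n 0 Q (\<lambda>w e. w \<in> A)"
        "real (length Q) \<le> (1 + \<epsilon>) * ?L + C"
      by blast
    then show "\<exists>\<phi>. sentence \<phi> \<and>
        real (quantifiers \<phi>) \<le> (1 + \<epsilon>) * log 2 (real n) + C \<and>
        (\<forall>w \<in> A. true_in (string_struct w) \<phi>) \<and>
        (\<forall>w \<in> strings n - A. \<not> true_in (string_struct w) \<phi>)"
      using sentence_of_prefix_definable[OF n A, of Q] by auto
  qed
qed

end
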